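(* Let $(\mathcal F,\mathcal R)$ be an AFSM and fix a sort quasi-ordering $\succeq^{\mathcal S}$ (defining $\mathit{Acc}$). For a set $I$ of terms, let $\rightsquigarrow_I$ be the relation with $\mathsf f\,s_1\cdots s_m\rightsquigarrow_I s_i\,t_1\cdots t_n$ whenever both sides have base type, $\mathsf f\in\mathcal F$, $i\in\mathit{Acc}(\mathsf f)$, and all $t_j$ are $I$-computable. Then there exists an RC-set $C$ for $\to_{\mathcal R}$ such that $C=\{s\in\mathcal T(\mathcal F,\mathcal V)\mid s$ has base type, $s$ is terminating under $\to_{\mathcal R}\cup\rightsquigarrow_C$, and whenever $s\to_{\mathcal R}^*\mathsf f\,s_1\cdots s_m$ with $\mathsf f\in\mathcal F$, the term $s_i$ is $C$-computable for every $i\in\mathit{Acc}(\mathsf f)\}$.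
   Context: Fix a set $\mathcal S$ of sorts. Types: every sort is a type, and $\sigma\to\tau$ is a type for types $\sigma,\tau$ ($\to$ right-associative); every type is uniquely $\sigma_1\to\cdots\to\sigma_m\to\iota$ with $\iota\in\mathcal S$. Fix pairwise disjoint sets $\mathcal F$ (function symbols), $\mathcal V$ (variables), $\mathcal M$ (meta-variables), each symbol with a type; each meta-variable $Z$ also has a natural number $\mathit{arity}(Z)$; $\mathcal V$ and $\mathcal M$ contain infinitely many symbols of every type. Meta-terms are typable by: $x:\sigma$ if $x:\sigma\in\mathcal V$; $\mathsf f:\sigma$ if $\mathsf f:\sigma\in\mathcal F$; $s\,t:\tau$ if $s:\sigma\to\tau$, $t:\sigma$; $\lambda x.s:\sigma\to\tau$ if $x:\sigma\in\mathcal V$, $s:\tau$; $Z\langle s_1,\dots,s_k\rangle:\sigma_{k+1}\to\cdots\to\sigma_m\to\iota$ if $Z$ has type $\sigma_1\to\cdots\to\sigma_m\to\iota$ and arity $k$ and $s_i:\sigma_i$. Terms are meta-terms without meta-variables; $\mathcal T(\mathcal F,\mathcal V)$ is the set of terms; a term has base type if its type is a sort. Application is left-associative, $\lambda$ binds variables, everything is modulo $\alpha$; $FV(s)$ = free variables, $FMV(s)$ = meta-variables; closed means $FV(s)=\emptyset$. A pattern is $Z\langle x_1,\dots,x_k\rangle$ with distinct variables, or $\lambda x.\ell$ with $\ell$ a pattern, or $a\,\ell_1\cdots\ell_n$ with $a\in\mathcal F\cup\mathcal V$ and patterns $\ell_i$. Substitutions $\gamma$ map variables and meta-variables to (meta-)terms,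 type-preservingly; $Z\langle s_1,..,s_k\rangle\gamma$ is computed by writing $\gamma(Z)=\lambda x_1\dots x_n.u$ ($n=k$, or $n<k$ and $u$ not an abstraction) and taking $u[x_1:=s_1\gamma,..,x_n:=s_n\gamma](s_{n+1}\gamma)\cdots(s_k\gamma)$; other constructs are substituted homomorphically (capture-avoiding). A rule is a pair $\ell\Rightarrow r$ of closed meta-terms of the same type with $\ell$ a pattern $\mathsf f\,\ell_1\cdots\ell_n$, $\mathsf f\in\mathcal F$, $FMV(r)\subseteq FMV(\ell)$; for a set of rules $\mathcal R$, $\to_{\mathcal R}$ is the smallest relation on terms closed under all contexts (application on either side, $\lambda$) containing $\ell\delta\to r\delta$ (rules, $\mathrm{dom}(\delta)=FMV(\ell)$) and $(\lambda x.s)\,t\to s[x:=t]$. An AFSM is such a pair $(\mathcal F,\mathcal R)$. Accessibility: $\succeq^{\mathcal S}$ is a quasi-ordering on sorts whose strict part $\succ^{\mathcal S}$ is well-founded. For a type $\sigma=\sigma_1\to\cdots\to\sigma_m\to\kappa$ ($\kappa$ a sort) and a sort $\iota$: $\iota\succeq^{\mathcal S}_+\sigma$ iff $\iota\succeq^{\mathcal S}\kappa$ and $\iota\succ^{\mathcal S}_-\sigma_i$ for all $i$; $\iota\succ^{\mathcal S}_-\sigma$ iff $\iota\succ^{\mathcal S}\kappa$ and $\iota\succeq^{\mathcal S}_+\sigma_i$ for all $i$. For $\mathsf f:\sigma_1\to\cdots\to\sigma_m\to\iota$ in $\mathcal F$, $\mathit{Acc}(\mathsf f)=\{i\mid1\le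 i\le m,\ \iota\succeq^{\mathcal S}_+\sigma_i\}$. RC-sets: an RC-set for $\to_{\mathcal R}$ is a set $I$ of base-type terms such that every term in $I$ is terminating under $\to_{\mathcal R}$; $I$ is closed under $\to_{\mathcal R}$; and if $s=x\,s_1\cdots s_n$ with $x\in\mathcal V$, or $s=(\lambda x.u)\,s_0\cdots s_n$ ($n\ge0$), and every $t$ with $s\to_{\mathcal R}t$ lies in $I$, then $s\in I$. For an RC-set $I$, $I$-computability is defined by induction on types: a base-type term $s$ is $I$-computable iff $s\in I$; $s:\sigma\to\tau$ is $I$-computable iff $s\,t$ is $I$-computable for every $I$-computable $t:\sigma$. *)

theory Defs
  imports Main
begin

section \<open>Types\<close>

datatype 's ty = Sort 's | Arrow "'s ty" "'s ty"  (infixr \<open>\<rightarrow>\<close> 65)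

primrec arg_tys :: "'s ty \<Rightarrow> 's ty list" where
  "arg_tys (Sort \<iota>) = []"
| "arg_tys (\<sigma> \<rightarrow> \<tau>) = \<sigma> # arg_tys \<tau>"

primrec out_sort :: "'s ty \<Rightarrow> 's" where
  "out_sort (Sort \<iota>) = \<iota>"
| "out_sort (\<sigma> \<rightarrow> \<tau>) = out_sort \<tau>"

abbreviation arrows :: "'s ty list \<Rightarrow> 's ty \<Rightarrow> 's ty" where
  "arrows \<sigma>s \<tau> \<equiv> foldr Arrow \<sigma>s \<tau>"

lemma arrows_arg_tys_out_sort: "arrows (arg_tys \<sigma>) (Sort (out_sort \<sigma>)) = \<sigma>"
  by (induction \<sigma>) auto

lemma size_arg_tys: "\<tau> \<in> set (arg_tys \<sigma>) \<Longrightarrow> size \<tau> < size \<sigma>"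
  by (induction \<sigma>) auto


section \<open>Meta-terms modulo alpha\<close>

text \<open>
  Alpha-equivalence classes of meta-terms are represented locally namelessly: free variables carry
  their name, bound variables are de Bruijn indices, and \<open>Abs\<close> records the type of the variable it
  binds.  The raw datatype also contains ill-typed objects and objects with dangling indices; the
  typing judgement below excludes both.  The named abstraction \<open>\<lambda>x. s\<close> is \<open>lam \<Sigma> x s\<close>,
  and all later definitions are phrased with it.  As bound variables are not of the form \<open>Var x\<close>,
  the set functions \<open>fv\<close> and \<open>fmv\<close> of the datatype are \<open>FV\<close> and \<open>FMV\<close>.
\<close>

datatype ('s, 'f, fv: 'v, fmv: 'm) mterm =
    Var 'v
  | Bound nat
  | Fun 'f
  | App "('s, 'f, 'v, 'm) mterm" "('s, 'f, 'v, 'm) mterm"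
  | Abs "'s ty" "('s, 'f, 'v, 'm) mterm"
  | Meta 'm "('s, 'f, 'v, 'm) mterm list"

text \<open>
  The function symbols form the set \<open>funs\<close>, which may be empty.  All elements of \<open>'v\<close> and \<open>'m\<close>
  are variables and meta-variables; all elements of \<open>'s\<close> are sorts.
\<close>

record ('s, 'f, 'v, 'm) signature =
  funs :: "'f set"
  fun_ty :: "'f \<Rightarrow> 's ty"
  var_ty :: "'v \<Rightarrow> 's ty"
  meta_ty :: "'m \<Rightarrow> 's ty"
  arity :: "'m \<Rightarrow> nat"

definition wf_signature :: "('s, 'f, 'v, 'm) signature \<Rightarrow> bool" where
  "wf_signature \<Sigma> \<longleftrightarrow>
     (\<forall>\<sigma>. infinite {x. var_ty \<Sigma> x = \<sigma>}) \<and> (\<forall>\<sigma>. infinite {Z. meta_ty \<Sigma> Z = \<sigma>})"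

abbreviation apps ::
  "('s, 'f, 'v, 'm) mterm \<Rightarrow> ('s, 'f, 'v, 'm) mterm list \<Rightarrow> ('s, 'f, 'v, 'm) mterm" where
  "apps s ts \<equiv> foldl App s ts"

primrec close :: "'v \<Rightarrow> nat \<Rightarrow> ('s, 'f, 'v, 'm) mterm \<Rightarrow> ('s, 'f, 'v, 'm) mterm" where
  "close x n (Var y) = (if y = x then Bound n else Var y)"
| "close x n (Bound i) = Bound i"
| "close x n (Fun f) = Fun f"
| "close x n (App s t) = App (close x n s) (close x n t)"
| "close x n (Abs \<sigma> s) = Abs \<sigma> (close x (Suc n) s)"
| "close x n (Meta Z ss) = Meta Z (map (close x n) ss)"

definition lam ::
  "('s, 'f, 'v, 'm) signature \<Rightarrow> 'v \<Rightarrow> ('s, 'f, 'v, 'm) mterm \<Rightarrow> ('s, 'f, 'v, 'm) mterm" where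
  "lam \<Sigma> x s = Abs (var_ty \<Sigma> x) (close x 0 s)"

inductive has_type ::
  "('s, 'f, 'v, 'm) signature \<Rightarrow> ('s, 'f, 'v, 'm) mterm \<Rightarrow> 's ty \<Rightarrow> bool" for \<Sigma> where
  ty_Var: "has_type \<Sigma> (Var x) (var_ty \<Sigma> x)"
| ty_Fun: "f \<in> funs \<Sigma> \<Longrightarrow> has_type \<Sigma> (Fun f) (fun_ty \<Sigma> f)"
| ty_App: "has_type \<Sigma> s (\<sigma> \<rightarrow> \<tau>) \<Longrightarrow> has_type \<Sigma> t \<sigma> \<Longrightarrow> has_type \<Sigma> (App s t) \<tau>"
| ty_lam: "has_type \<Sigma> s \<tau> \<Longrightarrow> has_type \<Sigma> (lam \<Sigma> x s) (var_ty \<Sigma> x \<rightarrow> \<tau>)"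
| ty_Meta: "meta_ty \<Sigma> Z = arrows \<sigma>s \<tau> \<Longrightarrow> length \<sigma>s = arity \<Sigma> Z \<Longrightarrow>
    list_all2 (has_type \<Sigma>) ss \<sigma>s \<Longrightarrow> has_type \<Sigma> (Meta Z ss) \<tau>"

definition term_of_type ::
  "('s, 'f, 'v, 'm) signature \<Rightarrow> ('s, 'f, 'v, 'm) mterm \<Rightarrow> 's ty \<Rightarrow> bool" where
  "term_of_type \<Sigma> s \<sigma> \<longleftrightarrow> has_type \<Sigma> s \<sigma> \<and> fmv s = {}"

definition terms :: "('s, 'f, 'v, 'm) signature \<Rightarrow> ('s, 'f, 'v, 'm) mterm set" where
  "terms \<Sigma> = {s. \<exists>\<sigma>. term_of_type \<Sigma> s \<sigma>}"

definition base_terms :: "('s, 'f, 'v, 'm) signature \<Rightarrow> ('s, 'f, 'v, 'm) mterm set" where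
  "base_terms \<Sigma> = {s. \<exists>\<iota>. term_of_type \<Sigma> s (Sort \<iota>)}"


section \<open>Substitution\<close>

primrec lift :: "nat \<Rightarrow> nat \<Rightarrow> ('s, 'f, 'v, 'm) mterm \<Rightarrow> ('s, 'f, 'v, 'm) mterm" where
  "lift d k (Var x) = Var x"
| "lift d k (Bound i) = Bound (if i < k then i else i + d)"
| "lift d k (Fun f) = Fun f"
| "lift d k (App s t) = App (lift d k s) (lift d k t)"
| "lift d k (Abs \<sigma> s) = Abs \<sigma> (lift d (Suc k) s)"
| "lift d k (Meta Z ss) = Meta Z (map (lift d k) ss)"

text \<open>
  \<open>inst [s\<^sub>1, \<dots>, s\<^sub>n] 0 u\<close> is \<open>u[x\<^sub>1 := s\<^sub>1, \<dots>, x\<^sub>n := s\<^sub>n]\<close> for the body \<open>u\<close> of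
  \<open>\<lambda>x\<^sub>1 \<dots> x\<^sub>n. u\<close>; the innermost \<open>x\<^sub>n\<close> has index \<open>0\<close>, hence the \<open>rev\<close>.
\<close>

primrec inst ::
  "('s, 'f, 'v, 'm) mterm list \<Rightarrow> nat \<Rightarrow> ('s, 'f, 'v, 'm) mterm \<Rightarrow> ('s, 'f, 'v, 'm) mterm" where
  "inst ss d (Var x) = Var x"
| "inst ss d (Bound i) =
    (if i < d then Bound i
     else if i < d + length ss then lift d 0 (rev ss ! (i - d))
     else Bound (i - length ss))"
| "inst ss d (Fun f) = Fun f"
| "inst ss d (App s t) = App (inst ss d s) (inst ss d t)"
| "inst ss d (Abs \<sigma> s) = Abs \<sigma> (inst ss (Suc d) s)"
| "inst ss d (Meta Z ts) = Meta Z (map (inst ss d) ts)"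

text \<open>
  \<open>strip_abs k t = (n, u)\<close> writes \<open>t\<close> as \<open>\<lambda>x\<^sub>1 \<dots> x\<^sub>n. u\<close> with \<open>n = k\<close>, or \<open>n < k\<close> and
  \<open>u\<close> not an abstraction.
\<close>

fun strip_abs :: "nat \<Rightarrow> ('s, 'f, 'v, 'm) mterm \<Rightarrow> nat \<times> ('s, 'f, 'v, 'm) mterm" where
  "strip_abs (Suc k) (Abs \<sigma> s) = (case strip_abs k s of (n, u) \<Rightarrow> (Suc n, u))"
| "strip_abs k s = (0, s)"

definition meta_app ::
  "('s, 'f, 'v, 'm) mterm \<Rightarrow> ('s, 'f, 'v, 'm) mterm list \<Rightarrow> ('s, 'f, 'v, 'm) mterm" where
  "meta_app t ss =
     (case strip_abs (length ss) t of (n, u) \<Rightarrow> apps (inst (take n ss) 0 u) (drop n ss))"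

text \<open>
  A substitution is a partial map on variables (\<open>Inl\<close>) and meta-variables (\<open>Inr\<close>); symbols outside
  its domain are left unchanged.
\<close>

type_synonym ('s, 'f, 'v, 'm) substitution = "'v + 'm \<rightharpoonup> ('s, 'f, 'v, 'm) mterm"

definition is_substitution ::
  "('s, 'f, 'v, 'm) signature \<Rightarrow> ('s, 'f, 'v, 'm) substitution \<Rightarrow> bool" where
  "is_substitution \<Sigma> \<gamma> \<longleftrightarrow>
     (\<forall>x t. \<gamma> (Inl x) = Some t \<longrightarrow> has_type \<Sigma> t (var_ty \<Sigma> x)) \<and>
     (\<forall>Z t. \<gamma> (Inr Z) = Some t \<longrightarrow> has_type \<Sigma> t (meta_ty \<Sigma> Z))"

primrec subst ::
  "('s, 'f, 'v, 'm) substitution \<Rightarrow> ('s, 'f, 'v, 'm) mterm \<Rightarrow> ('s, 'f, 'v, 'm) mterm" where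
  "subst \<gamma> (Var x) = (case \<gamma> (Inl x) of None \<Rightarrow> Var x | Some t \<Rightarrow> t)"
| "subst \<gamma> (Bound i) = Bound i"
| "subst \<gamma> (Fun f) = Fun f"
| "subst \<gamma> (App s t) = App (subst \<gamma> s) (subst \<gamma> t)"
| "subst \<gamma> (Abs \<sigma> s) = Abs \<sigma> (subst \<gamma> s)"
| "subst \<gamma> (Meta Z ss) =
    (case \<gamma> (Inr Z) of
       None \<Rightarrow> Meta Z (map (subst \<gamma>) ss)
     | Some t \<Rightarrow> meta_app t (map (subst \<gamma>) ss))"


subsection \<open>Adequacy of the encoding with respect to named abstraction\<close>

lemma close_subst_Var:
  "y \<notin> fv s \<Longrightarrow> close y n (subst [Inl x \<mapsto> Var y] s) = close x n s"
  by (induction s arbitrary: n) auto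

lemma lam_alpha:
  assumes "var_ty \<Sigma> y = var_ty \<Sigma> x" and "y \<notin> fv s"
  shows "lam \<Sigma> x s = lam \<Sigma> y (subst [Inl x \<mapsto> Var y] s)"
  using assms by (simp add: lam_def close_subst_Var)

lemma close_fresh: "x \<notin> fv s \<Longrightarrow> close x n s = s"
  by (induction s arbitrary: n) (auto intro: map_idI)

lemma close_lift: "k \<le> n \<Longrightarrow> close x (n + d) (lift d k s) = lift d k (close x n s)"
proof (induction s arbitrary: n k)
  case (Abs \<sigma> s)
  from Abs.IH[of "Suc k" "Suc n"] Abs.prems show ?case by simp
qed auto

lemma close_inst:
  "x \<notin> fv u \<Longrightarrow> close x (n + d) (inst ss d u) = inst (map (close x n) ss) d u"
proof (induction u arbitrary: d)
  case (Bound i)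
  then show ?case by (auto simp: close_lift rev_map)
next
  case (Abs \<sigma> u)
  from Abs.IH[of "Suc d"] Abs.prems show ?case by simp
qed auto

lemma close_apps: "close x n (apps s ts) = apps (close x n s) (map (close x n) ts)"
  by (induction ts arbitrary: s) auto

lemma fv_strip_abs: "strip_abs k t = (n, u) \<Longrightarrow> fv u = fv t"
  by (induction k t arbitrary: n u rule: strip_abs.induct) (auto split: prod.splits)

lemma close_meta_app:
  "x \<notin> fv t \<Longrightarrow> close x n (meta_app t ss) = meta_app t (map (close x n) ss)"
proof -
  assume x: "x \<notin> fv t"
  obtain k u where u: "strip_abs (length ss) t = (k, u)" by fastforce
  with x have "x \<notin> fv u" by (simp add: fv_strip_abs)
  from close_inst[OF this, of n 0] u show ?thesis
    by (simp add: meta_app_def close_apps take_map drop_map)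
qed

lemma close_subst:
  assumes "\<gamma> (Inl x) = None" and "\<And>b t. \<gamma> b = Some t \<Longrightarrow> x \<notin> fv t"
  shows "close x n (subst \<gamma> s) = subst \<gamma> (close x n s)"
  using assms
  by (induction s arbitrary: n)
     (auto simp: close_fresh close_meta_app comp_def cong: map_cong split: option.splits)

lemma subst_lam:
  assumes "\<gamma> (Inl x) = None" and "\<And>b t. \<gamma> b = Some t \<Longrightarrow> x \<notin> fv t"
  shows "subst \<gamma> (lam \<Sigma> x s) = lam \<Sigma> x (subst \<gamma> s)"
  using assms by (simp add: lam_def close_subst)

primrec lc :: "nat \<Rightarrow> ('s, 'f, 'v, 'm) mterm \<Rightarrow> bool" where
  "lc n (Var y) \<longleftrightarrow> True"
| "lc n (Bound i) \<longleftrightarrow> i < n"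
| "lc n (Fun f) \<longleftrightarrow> True"
| "lc n (App s t) \<longleftrightarrow> lc n s \<and> lc n t"
| "lc n (Abs \<sigma> s) \<longleftrightarrow> lc (Suc n) s"
| "lc n (Meta Z ss) \<longleftrightarrow> list_all (lc n) ss"

lemma lc_close: "lc n s \<Longrightarrow> lc (Suc n) (close x n s)"
  by (induction s arbitrary: n) (auto simp: list_all_iff)

lemma has_type_lc: "has_type \<Sigma> s \<sigma> \<Longrightarrow> lc 0 s"
proof (induction rule: has_type.induct)
  case (ty_Meta Z \<sigma>s \<tau> ss)
  then show ?case by (auto simp: list_all_iff list_all2_conv_all_nth in_set_conv_nth)
qed (auto simp: lam_def lc_close)

lemma lift_lc: "lc k s \<Longrightarrow> lift d k s = s"
  by (induction s arbitrary: k) (auto simp: list_all_iff intro: map_idI)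

primrec closes :: "'v list \<Rightarrow> nat \<Rightarrow> ('s, 'f, 'v, 'm) mterm \<Rightarrow> ('s, 'f, 'v, 'm) mterm" where
  "closes [] d u = u"
| "closes (x # xs) d u = close x (d + length xs) (closes xs d u)"

lemma closes_simps [simp]:
  "closes xs d (Bound i) = Bound i"
  "closes xs d (Fun f) = Fun f"
  "closes xs d (App s t) = App (closes xs d s) (closes xs d t)"
  "closes xs d (Abs \<sigma> s) = Abs \<sigma> (closes xs (Suc d) s)"
  "closes xs d (Meta Z ss) = Meta Z (map (closes xs d) ss)"
  by (induction xs) (auto simp: map_idI)

lemma closes_Var_notin: "y \<notin> set xs \<Longrightarrow> closes xs d (Var y) = Var y"
  by (induction xs) auto

lemma closes_Var_nth:
  "distinct xs \<Longrightarrow> i < length xs \<Longrightarrow> closes xs d (Var (xs ! i)) = Bound (d + (length xs - Suc i))"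
proof (induction xs arbitrary: i)
  case (Cons x xs)
  then show ?case by (cases i) (auto simp: closes_Var_notin)
qed simp

lemma strip_abs_close:
  "strip_abs k s = (n, v) \<Longrightarrow> strip_abs k (close x d s) = (n, close x (d + n) v)"
proof (induction k s arbitrary: n v d rule: strip_abs.induct)
  case (1 k \<sigma> s)
  obtain n' v' where s: "strip_abs k s = (n', v')" by fastforce
  from "1.prems" s "1.IH"[of n' v' "Suc d"] show ?case by auto
qed auto

lemma strip_abs_lams:
  assumes "length xs = k \<or> length xs < k \<and> (\<forall>\<sigma> v. u \<noteq> Abs \<sigma> v)"
  shows "strip_abs k (foldr (lam \<Sigma>) xs u) = (length xs, closes xs 0 u)"
  using assms
proof (induction xs arbitrary: k)
  case Nil
  then show ?case by (cases u; cases k) (auto simp: map_idI)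
next
  case (Cons x xs)
  then obtain k' where k: "k = Suc k'" by (cases k) auto
  have IH: "strip_abs k' (foldr (lam \<Sigma>) xs u) = (length xs, closes xs 0 u)"
    using Cons k by auto
  show ?case using strip_abs_close[OF IH, of x 0] by (simp add: k lam_def[of \<Sigma> x])
qed

lemma inst_closes:
  fixes u :: "('s, 'f, 'v, 'm) mterm" and ss :: "('s, 'f, 'v, 'm) mterm list"
  assumes "distinct xs" and "length ss = length xs" and "list_all (lc 0) ss" and "lc d u"
  shows "inst ss d (closes xs d u) = subst (map_of (zip (map Inl xs) ss)) u"
  using assms(4)
proof (induction u arbitrary: d)
  case (Var y)
  show ?case
  proof (cases "y \<in> set xs")
    case True
    then obtain i where i: "i < length xs" "y = xs ! i" by (metis in_set_conv_nth)
    have "(map_of (zip (map Inl xs) ss) :: ('s, 'f, 'v, 'm) substitution) (map Inl xs ! i) =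
        Some (ss ! i)"
      using assms i by (intro map_of_zip_nth) (auto simp: distinct_map)
    moreover have "lift d 0 (ss ! i) = ss ! i"
      using assms i by (intro lift_lc) (auto simp: list_all_length)
    moreover have "length xs - Suc (length xs - Suc i) = i"
      using i by simp
    ultimately show ?thesis
      using assms i by (auto simp: closes_Var_nth rev_nth)
  next
    case False
    have "(map_of (zip (map Inl xs) ss) :: ('s, 'f, 'v, 'm) substitution) (Inl y) = None"
      using False assms by (auto simp: map_of_zip_is_None)
    then show ?thesis using False by (simp add: closes_Var_notin)
  qed
next
  case (Meta Z ts)
  have "(map_of (zip (map Inl xs) ss) :: ('s, 'f, 'v, 'm) substitution) (Inr Z) = None"
    using assms by (auto simp: map_of_zip_is_None)
  then show ?case using Meta by (auto simp: list_all_iff)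
qed auto

lemma subst_Meta_lams:
  fixes \<gamma> :: "('s, 'f, 'v, 'm) substitution" and ss
  defines "ts \<equiv> map (subst \<gamma>) ss"
  assumes "\<gamma> (Inr Z) = Some (foldr (lam \<Sigma>) xs u)" and "distinct xs" and "lc 0 u"
    and "list_all (lc 0) ts"
    and n: "length xs = length ss \<or> length xs < length ss \<and> (\<forall>\<sigma> v. u \<noteq> Abs \<sigma> v)"
  shows "subst \<gamma> (Meta Z ss) =
    apps (subst (map_of (zip (map Inl xs) (take (length xs) ts))) u) (drop (length xs) ts)"
proof -
  have len: "length ts = length ss" by (simp add: ts_def)
  have "list_all (lc 0) (take (length xs) ts)"
    using assms(5) by (auto simp: list_all_iff dest: in_set_takeD)
  then have "inst (take (length xs) ts) 0 (closes xs 0 u) =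
      subst (map_of (zip (map Inl xs) (take (length xs) ts))) u"
    using assms n len by (intro inst_closes) auto
  moreover have "strip_abs (length ts) (foldr (lam \<Sigma>) xs u) = (length xs, closes xs 0 u)"
    using n len by (intro strip_abs_lams) auto
  ultimately show ?thesis
    using assms(2) by (simp add: meta_app_def ts_def)
qed


section \<open>Rules and reduction\<close>

inductive pattern :: "('s, 'f, 'v, 'm) signature \<Rightarrow> ('s, 'f, 'v, 'm) mterm \<Rightarrow> bool" for \<Sigma> where
  pat_Meta: "distinct xs \<Longrightarrow> pattern \<Sigma> (Meta Z (map Var xs))"
| pat_lam: "pattern \<Sigma> l \<Longrightarrow> pattern \<Sigma> (lam \<Sigma> x l)"
| pat_Fun: "f \<in> funs \<Sigma> \<Longrightarrow> \<forall>l \<in> set ls. pattern \<Sigma> l \<Longrightarrow> pattern \<Sigma> (apps (Fun f) ls)"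
| pat_Var: "\<forall>l \<in> set ls. pattern \<Sigma> l \<Longrightarrow> pattern \<Sigma> (apps (Var x) ls)"

definition is_rule ::
  "('s, 'f, 'v, 'm) signature \<Rightarrow> ('s, 'f, 'v, 'm) mterm \<Rightarrow> ('s, 'f, 'v, 'm) mterm \<Rightarrow> bool" where
  "is_rule \<Sigma> l r \<longleftrightarrow>
     (\<exists>\<sigma>. has_type \<Sigma> l \<sigma> \<and> has_type \<Sigma> r \<sigma>) \<and> fv l = {} \<and> fv r = {} \<and>
     pattern \<Sigma> l \<and> (\<exists>f \<in> funs \<Sigma>. \<exists>ls. l = apps (Fun f) ls) \<and> fmv r \<subseteq> fmv l"

type_synonym ('s, 'f, 'v, 'm) rules = "(('s, 'f, 'v, 'm) mterm \<times> ('s, 'f, 'v, 'm) mterm) set"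

definition afsm :: "('s, 'f, 'v, 'm) signature \<Rightarrow> ('s, 'f, 'v, 'm) rules \<Rightarrow> bool" where
  "afsm \<Sigma> R \<longleftrightarrow> wf_signature \<Sigma> \<and> (\<forall>(l, r) \<in> R. is_rule \<Sigma> l r)"

inductive red ::
  "('s, 'f, 'v, 'm) signature \<Rightarrow> ('s, 'f, 'v, 'm) rules \<Rightarrow>
   ('s, 'f, 'v, 'm) mterm \<Rightarrow> ('s, 'f, 'v, 'm) mterm \<Rightarrow> bool" for \<Sigma> R where
  red_rule: "(l, r) \<in> R \<Longrightarrow> is_substitution \<Sigma> \<delta> \<Longrightarrow> dom \<delta> = Inr ` fmv l \<Longrightarrow>
    subst \<delta> l \<in> terms \<Sigma> \<Longrightarrow> subst \<delta> r \<in> terms \<Sigma> \<Longrightarrow> red \<Sigma> R (subst \<delta> l) (subst \<delta> r)"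
| red_beta: "s \<in> terms \<Sigma> \<Longrightarrow> t \<in> terms \<Sigma> \<Longrightarrow> App (lam \<Sigma> x s) t \<in> terms \<Sigma> \<Longrightarrow>
    red \<Sigma> R (App (lam \<Sigma> x s) t) (subst [Inl x \<mapsto> t] s)"
| red_AppL: "red \<Sigma> R s s' \<Longrightarrow> App s t \<in> terms \<Sigma> \<Longrightarrow> red \<Sigma> R (App s t) (App s' t)"
| red_AppR: "red \<Sigma> R t t' \<Longrightarrow> App s t \<in> terms \<Sigma> \<Longrightarrow> red \<Sigma> R (App s t) (App s t')"
| red_lam: "red \<Sigma> R s s' \<Longrightarrow> red \<Sigma> R (lam \<Sigma> x s) (lam \<Sigma> x s')"

definition terminating :: "('a \<Rightarrow> 'a \<Rightarrow> bool) \<Rightarrow> 'a \<Rightarrow> bool" where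
  "terminating r s \<longleftrightarrow> \<not> (\<exists>S :: nat \<Rightarrow> 'a. S 0 = s \<and> (\<forall>i. r (S i) (S (Suc i))))"


section \<open>Accessibility\<close>

text \<open>A relation \<open>ge\<close> is read with the larger sort first: \<open>ge \<iota> \<kappa>\<close> is \<open>\<iota> \<succeq> \<kappa>\<close>.\<close>

definition sort_gt :: "('s \<Rightarrow> 's \<Rightarrow> bool) \<Rightarrow> 's \<Rightarrow> 's \<Rightarrow> bool" where
  "sort_gt ge \<iota> \<kappa> \<longleftrightarrow> ge \<iota> \<kappa> \<and> \<not> ge \<kappa> \<iota>"

definition sort_ordering :: "('s \<Rightarrow> 's \<Rightarrow> bool) \<Rightarrow> bool" where
  "sort_ordering ge \<longleftrightarrow> reflp ge \<and> transp ge \<and> wfp (\<lambda>\<kappa> \<iota>. sort_gt ge \<iota> \<kappa>)"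

function ge_plus :: "('s \<Rightarrow> 's \<Rightarrow> bool) \<Rightarrow> 's \<Rightarrow> 's ty \<Rightarrow> bool"
  and gt_minus :: "('s \<Rightarrow> 's \<Rightarrow> bool) \<Rightarrow> 's \<Rightarrow> 's ty \<Rightarrow> bool" where
  "ge_plus ge \<iota> \<sigma> \<longleftrightarrow> ge \<iota> (out_sort \<sigma>) \<and> (\<forall>\<tau> \<in> set (arg_tys \<sigma>). gt_minus ge \<iota> \<tau>)"
| "gt_minus ge \<iota> \<sigma> \<longleftrightarrow> sort_gt ge \<iota> (out_sort \<sigma>) \<and> (\<forall>\<tau> \<in> set (arg_tys \<sigma>). ge_plus ge \<iota> \<tau>)"
  by pat_completeness auto
termination
  by (relation "measure (case_sum (\<lambda>(_, _, \<sigma>). size \<sigma>) (\<lambda>(_, _, \<sigma>). size \<sigma>))")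
     (auto simp: size_arg_tys)

declare ge_plus.simps [simp del] gt_minus.simps [simp del]

definition Acc :: "('s, 'f, 'v, 'm) signature \<Rightarrow> ('s \<Rightarrow> 's \<Rightarrow> bool) \<Rightarrow> 'f \<Rightarrow> nat set" where
  "Acc \<Sigma> ge f = {i. 1 \<le> i \<and> i \<le> length (arg_tys (fun_ty \<Sigma> f)) \<and>
     ge_plus ge (out_sort (fun_ty \<Sigma> f)) (arg_tys (fun_ty \<Sigma> f) ! (i - 1))}"


section \<open>Computability\<close>

definition rc_set ::
  "('s, 'f, 'v, 'm) signature \<Rightarrow> ('s, 'f, 'v, 'm) rules \<Rightarrow> ('s, 'f, 'v, 'm) mterm set \<Rightarrow> bool" where
  "rc_set \<Sigma> R I \<longleftrightarrow>
     I \<subseteq> base_terms \<Sigma> \<and>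
     (\<forall>s \<in> I. terminating (red \<Sigma> R) s) \<and>
     (\<forall>s \<in> I. \<forall>t. red \<Sigma> R s t \<longrightarrow> t \<in> I) \<and>
     (\<forall>s \<in> base_terms \<Sigma>.
        ((\<exists>x ss. s = apps (Var x) ss) \<or> (\<exists>x u s0 ss. s = apps (lam \<Sigma> x u) (s0 # ss))) \<longrightarrow>
        (\<forall>t. red \<Sigma> R s t \<longrightarrow> t \<in> I) \<longrightarrow> s \<in> I)"

primrec computable_at ::
  "('s, 'f, 'v, 'm) signature \<Rightarrow> ('s, 'f, 'v, 'm) mterm set \<Rightarrow> 's ty \<Rightarrow>
   ('s, 'f, 'v, 'm) mterm \<Rightarrow> bool" where
  "computable_at \<Sigma> I (Sort \<iota>) s \<longleftrightarrow> term_of_type \<Sigma> s (Sort \<iota>) \<and> s \<in> I"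
| "computable_at \<Sigma> I (\<sigma> \<rightarrow> \<tau>) s \<longleftrightarrow> term_of_type \<Sigma> s (\<sigma> \<rightarrow> \<tau>) \<and>
     (\<forall>t. computable_at \<Sigma> I \<sigma> t \<longrightarrow> computable_at \<Sigma> I \<tau> (App s t))"

definition computable ::
  "('s, 'f, 'v, 'm) signature \<Rightarrow> ('s, 'f, 'v, 'm) mterm set \<Rightarrow> ('s, 'f, 'v, 'm) mterm \<Rightarrow> bool" where
  "computable \<Sigma> I s \<longleftrightarrow> (\<exists>\<sigma>. computable_at \<Sigma> I \<sigma> s)"

text \<open>
  Argument positions are counted from 1 and lists from 0.  In \<open>acc_red\<close> the left-hand side has
  base type, so \<open>f\<close> is applied to all its arguments and \<open>i \<le> length ss\<close>.
\<close>

inductive acc_red ::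
  "('s, 'f, 'v, 'm) signature \<Rightarrow> ('s \<Rightarrow> 's \<Rightarrow> bool) \<Rightarrow> ('s, 'f, 'v, 'm) mterm set \<Rightarrow>
   ('s, 'f, 'v, 'm) mterm \<Rightarrow> ('s, 'f, 'v, 'm) mterm \<Rightarrow> bool" for \<Sigma> ge I where
  "f \<in> funs \<Sigma> \<Longrightarrow> i \<in> Acc \<Sigma> ge f \<Longrightarrow> \<forall>t \<in> set ts. computable \<Sigma> I t \<Longrightarrow>
   apps (Fun f) ss \<in> base_terms \<Sigma> \<Longrightarrow> apps (ss ! (i - 1)) ts \<in> base_terms \<Sigma> \<Longrightarrow>
   acc_red \<Sigma> ge I (apps (Fun f) ss) (apps (ss ! (i - 1)) ts)"

end

theory Submission
  imports Defs
begin

text \<open>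
  The set \<open>C\<close> is built sort by sort, by well-founded recursion along \<open>\<succ>\<close>.  Once \<open>C\<close> is known at
  all sorts below \<open>\<iota>\<close>, computability at a type \<open>\<sigma>\<close> is monotone in the part of \<open>C\<close> at \<open>\<iota>\<close> if
  \<open>\<iota> \<succeq>\<^sub>+ \<sigma>\<close>, and antitone if \<open>\<iota> \<succ>\<^sub>- \<sigma>\<close>.  An accessible argument satisfies the former, and
  the arguments it is applied to in an accessibility step the latter; hence enlarging \<open>C\<close> at \<open>\<iota>\<close>
  removes accessibility steps and weakens the computability requirement, so the defining
  condition of \<open>C\<close> is monotone and has a fixpoint.  By subject reduction, every fixpoint is an RC-set.
\<close>

section \<open>Typing with de Bruijn contexts\<close>

text \<open>\<open>has_type\<close> types abstractions through named variables and says nothing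
  about bodies with dangling indices. Here the context lists the types of those indices, innermost
  first, so that induction can pass under binders.\<close>

inductive hty ::
  "('s, 'f, 'v, 'm) signature \<Rightarrow> 's ty list \<Rightarrow> ('s, 'f, 'v, 'm) mterm \<Rightarrow> 's ty \<Rightarrow> bool" for \<Sigma> where
  hty_Var: "hty \<Sigma> \<Gamma> (Var x) (var_ty \<Sigma> x)"
| hty_Bound: "i < length \<Gamma> \<Longrightarrow> hty \<Sigma> \<Gamma> (Bound i) (\<Gamma> ! i)"
| hty_Fun: "f \<in> funs \<Sigma> \<Longrightarrow> hty \<Sigma> \<Gamma> (Fun f) (fun_ty \<Sigma> f)"
| hty_App: "hty \<Sigma> \<Gamma> s (\<sigma> \<rightarrow> \<tau>) \<Longrightarrow> hty \<Sigma> \<Gamma> t \<sigma> \<Longrightarrow> hty \<Sigma> \<Gamma> (App s t) \<tau>"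
| hty_Abs: "hty \<Sigma> (\<sigma> # \<Gamma>) s \<tau> \<Longrightarrow> hty \<Sigma> \<Gamma> (Abs \<sigma> s) (\<sigma> \<rightarrow> \<tau>)"
| hty_Meta: "meta_ty \<Sigma> Z = arrows \<sigma>s \<tau> \<Longrightarrow> length \<sigma>s = arity \<Sigma> Z \<Longrightarrow>
    list_all2 (hty \<Sigma> \<Gamma>) ss \<sigma>s \<Longrightarrow> hty \<Sigma> \<Gamma> (Meta Z ss) \<tau>"

inductive_cases hty_VarE: "hty \<Sigma> \<Gamma> (Var x) \<tau>"
inductive_cases hty_BoundE: "hty \<Sigma> \<Gamma> (Bound i) \<tau>"
inductive_cases hty_FunE: "hty \<Sigma> \<Gamma> (Fun f) \<tau>"
inductive_cases hty_AppE: "hty \<Sigma> \<Gamma> (App s t) \<tau>"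
inductive_cases hty_AbsE: "hty \<Sigma> \<Gamma> (Abs \<sigma> s) \<tau>"
inductive_cases hty_MetaE: "hty \<Sigma> \<Gamma> (Meta Z ss) \<tau>"

lemma arrows_inject:
  "arrows \<sigma>s \<sigma> = arrows \<tau>s \<tau> \<Longrightarrow> length \<sigma>s = length \<tau>s \<Longrightarrow> \<sigma>s = \<tau>s \<and> \<sigma> = \<tau>"
proof (induction \<sigma>s arbitrary: \<tau>s)
  case (Cons a \<sigma>s)
  then show ?case by (cases \<tau>s) auto
qed auto

lemma arg_tys_arrows [simp]: "arg_tys (arrows \<sigma>s (Sort \<iota>)) = \<sigma>s"
  by (induction \<sigma>s) auto

lemma out_sort_arrows [simp]: "out_sort (arrows \<sigma>s \<tau>) = out_sort \<tau>"
  by (induction \<sigma>s) auto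

text \<open>Every construct determines its type: \<open>Abs\<close> records the type of its
  variable, and the arity fixes how many argument types are split off
  \<open>meta_ty\<close>.\<close>

lemma hty_unique: "hty \<Sigma> \<Gamma> s \<sigma> \<Longrightarrow> hty \<Sigma> \<Gamma> s \<tau> \<Longrightarrow> \<sigma> = \<tau>"
proof (induction arbitrary: \<tau> rule: hty.induct)
  case (hty_App \<Gamma> s \<sigma> \<rho> t)
  from hty_App.prems obtain \<sigma>' where "hty \<Sigma> \<Gamma> s (\<sigma>' \<rightarrow> \<tau>)" by (auto elim: hty_AppE)
  from hty_App.IH(1)[OF this] show ?case by simp
next
  case (hty_Abs \<sigma> \<Gamma> s \<rho>)
  from hty_Abs.prems obtain \<rho>' where "\<tau> = \<sigma> \<rightarrow> \<rho>'" "hty \<Sigma> (\<sigma> # \<Gamma>) s \<rho>'"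
    by (auto elim: hty_AbsE)
  with hty_Abs.IH[OF this(2)] show ?case by simp
next
  case (hty_Meta Z \<sigma>s \<rho> \<Gamma> ss)
  from hty_Meta.prems obtain \<tau>s where "meta_ty \<Sigma> Z = arrows \<tau>s \<tau>" "length \<tau>s = arity \<Sigma> Z"
    by (auto elim: hty_MetaE)
  with hty_Meta.hyps(1,2) show ?case using arrows_inject by metis
qed (auto elim: hty_VarE hty_BoundE hty_FunE)

lemma hty_lc: "hty \<Sigma> \<Gamma> s \<sigma> \<Longrightarrow> lc (length \<Gamma>) s"
proof (induction rule: hty.induct)
  case (hty_Meta Z \<sigma>s \<tau> \<Gamma> ss)
  then show ?case by (auto simp: list_all_iff list_all2_conv_all_nth in_set_conv_nth)
qed auto

section \<open>Stability of typing under changes of context and instantiation\<close>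

lemma hty_weaken: "hty \<Sigma> \<Gamma> s \<sigma> \<Longrightarrow> hty \<Sigma> (\<Gamma> @ \<Delta>) s \<sigma>"
proof (induction rule: hty.induct)
  case (hty_Bound i \<Gamma>)
  then show ?case using hty.hty_Bound[of i "\<Gamma> @ \<Delta>"] by (simp add: nth_append)
next
  case (hty_Meta Z \<sigma>s \<tau> \<Gamma> ss)
  then show ?case by (auto intro!: hty.hty_Meta elim: list_all2_mono)
qed (auto intro: hty.intros)

text \<open>Below \<open>length \<Gamma>\<close> binders the closed variable receives the next free
  index, so its type enters at the outer end of the context.\<close>

lemma hty_close:
  "hty \<Sigma> \<Gamma> s \<sigma> \<Longrightarrow> hty \<Sigma> (\<Gamma> @ [var_ty \<Sigma> x]) (close x (length \<Gamma>) s) \<sigma>"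
proof (induction rule: hty.induct)
  case (hty_Var \<Gamma> y)
  show ?case
    using hty.hty_Bound[of "length \<Gamma>" "\<Gamma> @ [var_ty \<Sigma> x]"] by (auto intro: hty.hty_Var)
next
  case (hty_Bound i \<Gamma>)
  then show ?case using hty.hty_Bound[of i "\<Gamma> @ [var_ty \<Sigma> x]"] by (simp add: nth_append)
next
  case (hty_Meta Z \<sigma>s \<tau> \<Gamma> ss)
  then show ?case by (auto intro!: hty.hty_Meta simp: list_all2_map1 elim: list_all2_mono)
qed (auto intro: hty.intros)

lemma hty_lift:
  "hty \<Sigma> (\<Delta>' @ \<Gamma>) s \<sigma> \<Longrightarrow> hty \<Sigma> (\<Delta>' @ \<Delta> @ \<Gamma>) (lift (length \<Delta>) (length \<Delta>') s) \<sigma>"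
proof (induction "\<Delta>' @ \<Gamma>" s \<sigma> arbitrary: \<Delta>' rule: hty.induct)
  case (hty_Bound i)
  let ?j = "if i < length \<Delta>' then i else i + length \<Delta>"
  have "?j < length (\<Delta>' @ \<Delta> @ \<Gamma>)" "(\<Delta>' @ \<Delta> @ \<Gamma>) ! ?j = (\<Delta>' @ \<Gamma>) ! i"
    using hty_Bound by (auto simp: nth_append)
  then show ?case using hty.hty_Bound[of ?j "\<Delta>' @ \<Delta> @ \<Gamma>" \<Sigma>] by simp
next
  case (hty_Abs \<sigma> s \<tau>)
  from hty_Abs(2)[of "\<sigma> # \<Delta>'"] show ?case by (auto intro: hty.hty_Abs)
next
  case (hty_Meta Z \<sigma>s \<tau> ss)
  then show ?case by (auto intro!: hty.hty_Meta simp: list_all2_map1 elim: list_all2_mono)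
qed (auto intro: hty.intros)

text \<open>The last term of \<open>ss\<close> instantiates the innermost index, which is why the
  types enter the context reversed. The terms are typed in \<open>\<Gamma>\<close> alone and have to
  be lifted over \<open>\<Delta>\<close>.\<close>

lemma hty_inst:
  assumes "list_all2 (hty \<Sigma> \<Gamma>) ss \<sigma>s"
  shows "hty \<Sigma> (\<Delta> @ rev \<sigma>s @ \<Gamma>) u \<tau> \<Longrightarrow> hty \<Sigma> (\<Delta> @ \<Gamma>) (inst ss (length \<Delta>) u) \<tau>"
proof (induction "\<Delta> @ rev \<sigma>s @ \<Gamma>" u \<tau> arbitrary: \<Delta> rule: hty.induct)
  case (hty_Bound i)
  have len: "length ss = length \<sigma>s" using assms by (rule list_all2_lengthD)
  consider "i < length \<Delta>" | "length \<Delta> \<le> i" "i < length \<Delta> + length ss" | "length \<Delta> + length ss \<le> i"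
    by linarith
  then show ?case
  proof cases
    case 1
    then show ?thesis using hty.hty_Bound[of i "\<Delta> @ \<Gamma>" \<Sigma>] by (simp add: nth_append)
  next
    case 2
    have "list_all2 (hty \<Sigma> \<Gamma>) (rev ss) (rev \<sigma>s)" using assms by simp
    then have "hty \<Sigma> \<Gamma> (rev ss ! (i - length \<Delta>)) (rev \<sigma>s ! (i - length \<Delta>))"
      by (rule list_all2_nthD) (use 2 in simp)
    from hty_lift[of \<Sigma> "[]" \<Gamma>, simplified, OF this, of \<Delta>] 2 len show ?thesis
      by (auto simp: nth_append)
  next
    case 3
    have "i - length ss < length (\<Delta> @ \<Gamma>)" using 3 hty_Bound len by simp
    from hty.hty_Bound[OF this, of \<Sigma>] 3 len show ?thesis
      by (auto simp: nth_append add.commute split: if_splits)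
  qed
next
  case (hty_Abs \<sigma> s \<tau>)
  from hty_Abs(2)[of "\<sigma> # \<Delta>"] show ?case by (auto intro: hty.hty_Abs)
next
  case (hty_Meta Z \<sigma>s \<tau> ss)
  then show ?case by (auto intro!: hty.hty_Meta simp: list_all2_map1 elim: list_all2_mono)
qed (auto intro: hty.intros)

text \<open>Each stripped binder moves one argument type from the arrow to the front of the context,
  whence the reversed prefix.\<close>

lemma hty_strip_abs:
  "strip_abs k t = (n, u) \<Longrightarrow> hty \<Sigma> \<Delta> t (arrows \<sigma>s \<tau>) \<Longrightarrow> k = length \<sigma>s \<Longrightarrow>
   n \<le> k \<and> hty \<Sigma> (rev (take n \<sigma>s) @ \<Delta>) u (arrows (drop n \<sigma>s) \<tau>)"
proof (induction k t arbitrary: n u \<Delta> \<sigma>s rule: strip_abs.induct)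
  case (1 k \<sigma> s)
  obtain \<sigma>' \<sigma>s' where \<sigma>s: "\<sigma>s = \<sigma>' # \<sigma>s'" using "1.prems"(3) by (cases \<sigma>s) auto
  obtain n' where n': "strip_abs k s = (n', u)" "n = Suc n'"
    using "1.prems"(1) by (auto split: prod.splits)
  have "\<sigma>' = \<sigma>" "hty \<Sigma> (\<sigma> # \<Delta>) s (arrows \<sigma>s' \<tau>)"
    using "1.prems"(2) \<sigma>s by (auto elim: hty_AbsE)
  with "1.IH"[OF n'(1), of "\<sigma> # \<Delta>" \<sigma>s'] "1.prems"(3) \<sigma>s n'(2) show ?case by simp
qed auto

lemma hty_apps:
  "hty \<Sigma> \<Gamma> s (arrows \<sigma>s \<tau>) \<Longrightarrow> list_all2 (hty \<Sigma> \<Gamma>) ts \<sigma>s \<Longrightarrow> hty \<Sigma> \<Gamma> (apps s ts) \<tau>"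
proof (induction ts arbitrary: s \<sigma>s)
  case (Cons t ts)
  then obtain \<rho> \<rho>s where \<sigma>s: "\<sigma>s = \<rho> # \<rho>s" "hty \<Sigma> \<Gamma> t \<rho>" "list_all2 (hty \<Sigma> \<Gamma>) ts \<rho>s"
    by (auto simp: list_all2_Cons1)
  with Cons.prems(1) have "hty \<Sigma> \<Gamma> (App s t) (arrows \<rho>s \<tau>)" by (auto intro: hty_App)
  from Cons.IH[OF this \<sigma>s(3)] show ?case by simp
qed auto

text \<open>The body of \<open>t\<close> refers only to the stripped binders, so it can be weakened
  to the context of the arguments before they are instantiated.\<close>

lemma hty_meta_app:
  assumes t: "hty \<Sigma> [] t (arrows \<sigma>s \<tau>)" and ss: "list_all2 (hty \<Sigma> \<Gamma>) ss \<sigma>s"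
  shows "hty \<Sigma> \<Gamma> (meta_app t ss) \<tau>"
proof -
  obtain n u where u: "strip_abs (length ss) t = (n, u)" by fastforce
  have len: "length ss = length \<sigma>s" using ss by (rule list_all2_lengthD)
  from hty_strip_abs[OF u t len] have "hty \<Sigma> (rev (take n \<sigma>s)) u (arrows (drop n \<sigma>s) \<tau>)" by simp
  then have "hty \<Sigma> ([] @ rev (take n \<sigma>s) @ \<Gamma>) u (arrows (drop n \<sigma>s) \<tau>)"
    by (simp add: hty_weaken)
  from hty_inst[OF list_all2_takeI[OF ss] this]
  have "hty \<Sigma> \<Gamma> (inst (take n ss) 0 u) (arrows (drop n \<sigma>s) \<tau>)" by simp
  from hty_apps[OF this list_all2_dropI[OF ss]] u show ?thesis by (simp add: meta_app_def)
qed

section \<open>Agreement of the two typing judgements\<close>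

lemma has_type_imp_hty: "has_type \<Sigma> s \<sigma> \<Longrightarrow> hty \<Sigma> [] s \<sigma>"
proof (induction rule: has_type.induct)
  case (ty_lam s \<tau> x)
  from hty_close[OF ty_lam.IH, of x] show ?case by (auto simp: lam_def intro: hty_Abs)
next
  case (ty_Meta Z \<sigma>s \<tau> ss)
  then show ?case by (auto intro!: hty_Meta elim: list_all2_mono)
qed (auto intro: hty.intros)

text \<open>Lets the induction on size in \<open>hty_imp_has_type\<close> reach an opened
  body.\<close>

lemma size_inst_Var_le: "size (inst [Var x] d s) \<le> size s"
proof (induction s arbitrary: d)
  case (Meta Z ss)
  then show ?case by (auto intro!: size_list_pointwise)
qed (auto intro: add_mono)

lemma inst_Bound_0: "lc (Suc d) s \<Longrightarrow> inst [Bound 0] d s = s"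
  by (induction s arbitrary: d) (auto simp: list_all_iff intro: map_idI)

lemma finite_fv: "finite (fv s)"
  by (induction s) auto

text \<open>The body of an \<open>Abs\<close> is typed in a nonempty context, out of reach of
  structural induction. Induction on size allows it to be opened with a fresh variable, typed, and
  closed again by \<open>ty_lam\<close>.\<close>

lemma hty_imp_has_type:
  assumes "wf_signature \<Sigma>"
  shows "hty \<Sigma> [] s \<sigma> \<Longrightarrow> has_type \<Sigma> s \<sigma>"
proof (induction "size s" arbitrary: s \<sigma> rule: less_induct)
  case less
  show ?case
  proof (cases s)
    case (Var x)
    then show ?thesis using less.prems by (auto elim: hty_VarE intro: ty_Var)
  next
    case (Bound i)
    then show ?thesis using less.prems by (auto elim: hty_BoundE)
  next
    case (Fun f)
    then show ?thesis using less.prems by (auto elim: hty_FunE intro: ty_Fun)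
  next
    case (App u v)
    then obtain \<tau> where "hty \<Sigma> [] u (\<tau> \<rightarrow> \<sigma>)" "hty \<Sigma> [] v \<tau>"
      using less.prems by (auto elim: hty_AppE)
    then have "has_type \<Sigma> u (\<tau> \<rightarrow> \<sigma>)" "has_type \<Sigma> v \<tau>" using less.hyps App by simp_all
    then show ?thesis unfolding App by (rule ty_App)
  next
    case (Abs \<rho> u)
    then obtain \<tau> where \<sigma>: "\<sigma> = \<rho> \<rightarrow> \<tau>" and u: "hty \<Sigma> [\<rho>] u \<tau>"
      using less.prems by (auto elim: hty_AbsE)
    have "infinite ({x. var_ty \<Sigma> x = \<rho>} - fv u)"
      using assms finite_fv by (auto simp: wf_signature_def)
    then have "{x. var_ty \<Sigma> x = \<rho>} - fv u \<noteq> {}" by (metis finite.emptyI)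
    then obtain x where x: "var_ty \<Sigma> x = \<rho>" "x \<notin> fv u" by blast
    have "hty \<Sigma> [] (inst [Var x] 0 u) \<tau>"
      using hty_inst[of \<Sigma> "[]" "[Var x]" "[\<rho>]" "[]" u \<tau>] u x(1) hty_Var[of \<Sigma> "[]" x] by simp
    moreover have "size (inst [Var x] 0 u) < size s"
      using size_inst_Var_le[of x 0 u] Abs by simp
    ultimately have "has_type \<Sigma> (inst [Var x] 0 u) \<tau>" using less.hyps by blast
    \<comment> \<open>Closing turns the fresh variable into \<open>Bound 0\<close>, and
      instantiating index \<open>0\<close> by \<open>Bound 0\<close> changes nothing.\<close>
    moreover have "close x 0 (inst [Var x] 0 u) = u"
      using close_inst[OF x(2), of 0 0 "[Var x]"] inst_Bound_0[of 0 u] hty_lc[OF u] by simp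
    ultimately show ?thesis
      using ty_lam[of \<Sigma> "inst [Var x] 0 u" \<tau> x] x(1) Abs \<sigma> by (simp add: lam_def)
  next
    case (Meta Z ss)
    then obtain \<sigma>s where *: "meta_ty \<Sigma> Z = arrows \<sigma>s \<sigma>" "length \<sigma>s = arity \<Sigma> Z"
      "list_all2 (hty \<Sigma> []) ss \<sigma>s"
      using less.prems by (auto elim: hty_MetaE)
    have "list_all2 (has_type \<Sigma>) ss \<sigma>s"
      using *(3)
    proof (rule list.rel_mono_strong)
      fix u \<tau> assume "u \<in> set ss" "hty \<Sigma> [] u \<tau>"
      moreover from this have "size u < size s"
        using Meta by (auto simp: less_Suc_eq_le intro: size_list_estimation')
      ultimately show "has_type \<Sigma> u \<tau>" using less.hyps by blast
    qed
    with * Meta show ?thesis by (auto intro: ty_Meta)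
  qed
qed

lemma has_type_unique: "has_type \<Sigma> s \<sigma> \<Longrightarrow> has_type \<Sigma> s \<tau> \<Longrightarrow> \<sigma> = \<tau>"
  using has_type_imp_hty hty_unique by blast

text \<open>Substituted terms are typed in the empty context, hence in every context by weakening;
  an instantiated meta-variable is covered by \<open>hty_meta_app\<close>.\<close>

lemma hty_subst:
  assumes "is_substitution \<Sigma> \<gamma>"
  shows "hty \<Sigma> \<Gamma> s \<sigma> \<Longrightarrow> hty \<Sigma> \<Gamma> (subst \<gamma> s) \<sigma>"
proof (induction rule: hty.induct)
  case (hty_Var \<Gamma> x)
  then show ?case
    using assms hty_weaken[of \<Sigma> "[]" _ "var_ty \<Sigma> x" \<Gamma>]
    by (auto simp: is_substitution_def intro: hty.hty_Var has_type_imp_hty split: option.splits)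
next
  case (hty_Meta Z \<sigma>s \<tau> \<Gamma> ss)
  have ss: "list_all2 (hty \<Sigma> \<Gamma>) (map (subst \<gamma>) ss) \<sigma>s"
    using hty_Meta(3) by (auto simp: list_all2_map1 elim: list_all2_mono)
  show ?case
  proof (cases "\<gamma> (Inr Z)")
    case None
    with ss hty_Meta show ?thesis by (auto intro: hty.hty_Meta)
  next
    case (Some t)
    then have "hty \<Sigma> [] t (arrows \<sigma>s \<tau>)"
      using assms hty_Meta(1) by (metis has_type_imp_hty is_substitution_def)
    from hty_meta_app[OF this ss] Some show ?thesis by simp
  qed
qed (auto intro: hty.intros)


section \<open>Subject reduction\<close>

lemma has_type_AppE:
  assumes "has_type \<Sigma> (App s t) \<tau>"
  obtains \<sigma> where "has_type \<Sigma> s (\<sigma> \<rightarrow> \<tau>)" and "has_type \<Sigma> t \<sigma>"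
  using assms by (cases rule: has_type.cases) (auto simp: lam_def)

lemma has_type_appsE:
  assumes "has_type \<Sigma> (apps s ts) \<tau>"
  obtains \<sigma>s where "has_type \<Sigma> s (arrows \<sigma>s \<tau>)" and "list_all2 (has_type \<Sigma>) ts \<sigma>s"
  using assms
proof (induction ts arbitrary: s thesis)
  case (Cons t ts)
  from Cons.prems(2) obtain \<sigma>s
    where \<sigma>s: "has_type \<Sigma> (App s t) (arrows \<sigma>s \<tau>)" "list_all2 (has_type \<Sigma>) ts \<sigma>s"
    using Cons.IH[of "App s t"] by auto
  from \<sigma>s(1) obtain \<sigma> where "has_type \<Sigma> s (\<sigma> \<rightarrow> arrows \<sigma>s \<tau>)" "has_type \<Sigma> t \<sigma>"
    by (rule has_type_AppE)
  with \<sigma>s(2) Cons.prems(1)[of "\<sigma> # \<sigma>s"] show ?case by simp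
qed simp

lemma has_type_FunD: "has_type \<Sigma> (Fun f) \<sigma> \<Longrightarrow> \<sigma> = fun_ty \<Sigma> f"
  by (cases rule: has_type.cases) (auto simp: lam_def)

lemma fmv_close [simp]: "fmv (close x n s) = fmv s"
  by (induction s arbitrary: n) auto

lemma fmv_subst_Var: "fmv (subst [Inl x \<mapsto> t] s) \<subseteq> fmv s \<union> fmv t"
  by (induction s) auto

lemma has_type_subst_Var:
  assumes "wf_signature \<Sigma>" and "has_type \<Sigma> t (var_ty \<Sigma> x)" and "has_type \<Sigma> s \<sigma>"
  shows "has_type \<Sigma> (subst [Inl x \<mapsto> t] s) \<sigma>"
proof -
  have "is_substitution \<Sigma> [Inl x \<mapsto> t]" using assms(2) by (auto simp: is_substitution_def)
  from hty_subst[OF this has_type_imp_hty[OF assms(3)]] show ?thesis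
    by (rule hty_imp_has_type[OF assms(1)])
qed

text \<open>Asserting a common type, instead of preservation of a given one, also delivers
  typability of the left side; the case \<open>red_lam\<close> needs this, since that rule has no
  typing premise.\<close>

lemma red_typed:
  assumes afsm: "afsm \<Sigma> R" and "red \<Sigma> R s t"
  shows "\<exists>\<sigma>. term_of_type \<Sigma> s \<sigma> \<and> term_of_type \<Sigma> t \<sigma>"
  using assms(2)
proof (induction rule: red.induct)
  case (red_rule l r \<delta>)
  from red_rule(1) afsm obtain \<rho> where \<rho>: "has_type \<Sigma> l \<rho>" "has_type \<Sigma> r \<rho>"
    by (auto simp: afsm_def is_rule_def)
  from red_rule(4,5) obtain \<sigma> \<tau> where st: "term_of_type \<Sigma> (subst \<delta> l) \<sigma>" "term_of_type \<Sigma> (subst \<delta> r) \<tau>"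
    by (auto simp: terms_def)
  \<comment> \<open>Substitution preserves the type \<open>\<rho>\<close> shared by \<open>l\<close>
    and \<open>r\<close>, and types are unique.\<close>
  have "\<sigma> = \<rho>"
    using has_type_imp_hty hty_subst[OF red_rule(2) has_type_imp_hty[OF \<rho>(1)]] st(1)
    by (auto simp: term_of_type_def intro: hty_unique)
  moreover have "\<tau> = \<rho>"
    using has_type_imp_hty hty_subst[OF red_rule(2) has_type_imp_hty[OF \<rho>(2)]] st(2)
    by (auto simp: term_of_type_def intro: hty_unique)
  ultimately show ?case using st by blast
next
  case (red_beta s t x)
  obtain \<sigma> \<tau> where s: "term_of_type \<Sigma> s \<sigma>" and a: "term_of_type \<Sigma> (App (lam \<Sigma> x s) t) \<tau>"
    using red_beta by (auto simp: terms_def)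
  from a obtain \<rho> where \<rho>: "has_type \<Sigma> (lam \<Sigma> x s) (\<rho> \<rightarrow> \<tau>)" "has_type \<Sigma> t \<rho>"
    by (auto simp: term_of_type_def elim: has_type_AppE)
  have "has_type \<Sigma> (lam \<Sigma> x s) (var_ty \<Sigma> x \<rightarrow> \<sigma>)"
    using s by (auto simp: term_of_type_def intro: ty_lam)
  with \<rho> have "\<rho> = var_ty \<Sigma> x" "\<tau> = \<sigma>" by (auto dest: has_type_unique)
  then have "has_type \<Sigma> (subst [Inl x \<mapsto> t] s) \<tau>"
    using \<rho>(2) s afsm by (auto simp: afsm_def term_of_type_def intro: has_type_subst_Var)
  moreover have "fmv (subst [Inl x \<mapsto> t] s) = {}"
    using fmv_subst_Var[of x t s] s a by (auto simp: term_of_type_def)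
  ultimately show ?case using a by (auto simp: term_of_type_def)
next
  case (red_AppL s s' t)
  then obtain \<sigma> \<tau> where *: "term_of_type \<Sigma> s \<sigma>" "term_of_type \<Sigma> s' \<sigma>" "term_of_type \<Sigma> (App s t) \<tau>"
    by (auto simp: terms_def)
  then obtain \<rho> where "has_type \<Sigma> s (\<rho> \<rightarrow> \<tau>)" "has_type \<Sigma> t \<rho>"
    by (auto simp: term_of_type_def elim: has_type_AppE)
  moreover from this * have "\<sigma> = \<rho> \<rightarrow> \<tau>" by (auto simp: term_of_type_def intro: has_type_unique)
  ultimately have "term_of_type \<Sigma> (App s' t) \<tau>"
    using * by (auto simp: term_of_type_def intro: ty_App)
  with * show ?case by blast
next
  case (red_AppR t t' s)
  then obtain \<sigma> \<tau> where *: "term_of_type \<Sigma> t \<sigma>" "term_of_type \<Sigma> t' \<sigma>" "term_of_type \<Sigma> (App s t) \<tau>"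
    by (auto simp: terms_def)
  then obtain \<rho> where "has_type \<Sigma> s (\<rho> \<rightarrow> \<tau>)" "has_type \<Sigma> t \<rho>"
    by (auto simp: term_of_type_def elim: has_type_AppE)
  moreover from this * have "\<sigma> = \<rho>" by (auto simp: term_of_type_def intro: has_type_unique)
  ultimately have "term_of_type \<Sigma> (App s t') \<tau>"
    using * by (auto simp: term_of_type_def intro: ty_App)
  with * show ?case by blast
next
  case (red_lam s s' x)
  then obtain \<sigma> where *: "term_of_type \<Sigma> s \<sigma>" "term_of_type \<Sigma> s' \<sigma>" by blast
  then have "has_type \<Sigma> (lam \<Sigma> x s) (var_ty \<Sigma> x \<rightarrow> \<sigma>)" "has_type \<Sigma> (lam \<Sigma> x s') (var_ty \<Sigma> x \<rightarrow> \<sigma>)"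
    by (auto simp: term_of_type_def intro: ty_lam)
  with * show ?case by (auto simp: term_of_type_def lam_def)
qed

lemma term_of_type_unique: "term_of_type \<Sigma> s \<sigma> \<Longrightarrow> term_of_type \<Sigma> s \<tau> \<Longrightarrow> \<sigma> = \<tau>"
  using has_type_unique by (auto simp: term_of_type_def)

lemma red_preserves_type:
  "afsm \<Sigma> R \<Longrightarrow> red \<Sigma> R s t \<Longrightarrow> term_of_type \<Sigma> s \<sigma> \<Longrightarrow> term_of_type \<Sigma> t \<sigma>"
  using red_typed term_of_type_unique by blast

lemma rtranclp_red_preserves_type:
  assumes "afsm \<Sigma> R" and "(red \<Sigma> R)\<^sup>*\<^sup>* s t" and "term_of_type \<Sigma> s \<sigma>"
  shows "term_of_type \<Sigma> t \<sigma>"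
  using assms(2,3) by (induction rule: rtranclp_induct) (auto intro: red_preserves_type[OF assms(1)])


section \<open>Fixpoints of stratified monotone operators\<close>

text \<open>Equivalent sorts may depend on each other, so a whole equivalence class is solved at
  once. With the layers strictly below held fixed, \<open>mono\<close> makes the operator on the
  class monotone, and Knaster-Tarski supplies a least fixpoint; the layers are then glued.\<close>

lemma stratified_fixpoint:
  fixes ge :: "'s \<Rightarrow> 's \<Rightarrow> bool" and P :: "'s \<Rightarrow> 'a set" and \<Phi> :: "'a set \<Rightarrow> 'a set"
  assumes ord: "sort_ordering ge"
    and disj: "\<And>s \<iota> \<kappa>. s \<in> P \<iota> \<Longrightarrow> s \<in> P \<kappa> \<Longrightarrow> \<iota> = \<kappa>"
    and cover: "\<And>X. \<Phi> X \<subseteq> (\<Union>\<iota>. P \<iota>)"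
    and mono: "\<And>\<iota> X Y. (\<And>\<kappa>. ge \<iota> \<kappa> \<Longrightarrow> X \<inter> P \<kappa> \<subseteq> Y \<inter> P \<kappa>) \<Longrightarrow>
      (\<And>\<kappa>. sort_gt ge \<iota> \<kappa> \<Longrightarrow> X \<inter> P \<kappa> = Y \<inter> P \<kappa>) \<Longrightarrow> \<Phi> X \<inter> P \<iota> \<subseteq> \<Phi> Y \<inter> P \<iota>"
  obtains C where "C = \<Phi> C"
proof -
  have refl: "ge \<iota> \<iota>" for \<iota> using ord by (auto simp: sort_ordering_def dest: reflpD)
  have trans: "ge \<iota> \<kappa> \<Longrightarrow> ge \<kappa> \<mu> \<Longrightarrow> ge \<iota> \<mu>" for \<iota> \<kappa> \<mu>
    using ord by (auto simp: sort_ordering_def dest: transpD)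
  \<comment> \<open>\<open>Q \<iota>\<close> joins the layers of all sorts equivalent to
    \<open>\<iota>\<close>; \<open>L g \<iota>\<close> collects the layers strictly below, as given
    by \<open>g\<close>.\<close>
  define Q where "Q \<iota> = (\<Union>\<kappa>\<in>{\<kappa>. ge \<iota> \<kappa> \<and> ge \<kappa> \<iota>}. P \<kappa>)" for \<iota>
  define L :: "('s \<Rightarrow> 'a set) \<Rightarrow> 's \<Rightarrow> 'a set" where
    "L g \<iota> = (\<Union>\<kappa>\<in>{\<kappa>. sort_gt ge \<iota> \<kappa>}. g \<kappa> \<inter> P \<kappa>)" for g \<iota>
  define H where "H g \<iota> X = \<Phi> (L g \<iota> \<union> X \<inter> Q \<iota>) \<inter> Q \<iota>" for g \<iota> X
  define r where "r = {(\<kappa>, \<iota>). sort_gt ge \<iota> \<kappa>}"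
  define G where "G = wfrec r (\<lambda>g \<iota>. lfp (H g \<iota>))"
  have wf: "wf r" using ord by (auto simp: sort_ordering_def r_def wfp_def)
  \<comment> \<open>\<open>L\<close> consults its argument only strictly below
    \<open>\<iota>\<close>, where the cut agrees with \<open>G\<close>.\<close>
  have L_cut: "L (cut G r \<iota>) \<iota> = L G \<iota>" for \<iota>
    by (auto simp: L_def r_def cut_apply)
  have H_cut: "H (cut G r \<iota>) \<iota> = H G \<iota>" for \<iota>
    by (simp add: H_def L_cut fun_eq_iff)
  have "G \<iota> = lfp (H (cut G r \<iota>) \<iota>)" for \<iota>
    unfolding G_def by (subst wfrec[OF wf]) simp
  then have G_lfp: "G \<iota> = lfp (H G \<iota>)" for \<iota> by (simp add: H_cut)
  have gt_cong: "sort_gt ge \<iota> = sort_gt ge \<kappa>" if "ge \<iota> \<kappa>" "ge \<kappa> \<iota>" for \<iota> \<kappa>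
    using that trans unfolding sort_gt_def by blast
  have Q_cong: "Q \<iota> = Q \<kappa>" if "ge \<iota> \<kappa>" "ge \<kappa> \<iota>" for \<iota> \<kappa>
    using that trans unfolding Q_def by blast
  \<comment> \<open>Equivalent sorts have the same lower layers and the same class, hence the same
    operator.\<close>
  have G_cong: "G \<iota> = G \<kappa>" if "ge \<iota> \<kappa>" "ge \<kappa> \<iota>" for \<iota> \<kappa>
  proof -
    have "H G \<iota> = H G \<kappa>"
      by (simp add: fun_eq_iff H_def L_def gt_cong[OF that] Q_cong[OF that])
    then have "lfp (H G \<iota>) = lfp (H G \<kappa>)" by (rule arg_cong)
    then show ?thesis by (simp only: G_lfp[symmetric])
  qed
  have Q_gt: "Q \<iota> \<inter> P \<kappa> = {}" if "sort_gt ge \<iota> \<kappa>" for \<iota> \<kappa>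
    using that disj unfolding Q_def sort_gt_def by blast
  have "mono (H G \<iota>)" for \<iota>
  proof (rule monoI, rule subsetI)
    fix X Y :: "'a set" and s assume XY: "X \<subseteq> Y" and s: "s \<in> H G \<iota> X"
    then obtain \<kappa> where \<kappa>: "ge \<iota> \<kappa>" "ge \<kappa> \<iota>" "s \<in> P \<kappa>" by (auto simp: H_def Q_def)
    \<comment> \<open>Monotonicity is applied at the layer \<open>\<kappa>\<close> containing
      \<open>s\<close>: layers strictly below it miss \<open>Q \<iota>\<close>, so both arguments
      agree there.\<close>
    have "\<Phi> (L G \<iota> \<union> X \<inter> Q \<iota>) \<inter> P \<kappa> \<subseteq> \<Phi> (L G \<iota> \<union> Y \<inter> Q \<iota>) \<inter> P \<kappa>"
    proof (rule mono)
      fix \<mu> assume "sort_gt ge \<kappa> \<mu>"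
      then have "Q \<iota> \<inter> P \<mu> = {}" by (simp add: Q_gt gt_cong[OF \<kappa>(1,2)])
      then show "(L G \<iota> \<union> X \<inter> Q \<iota>) \<inter> P \<mu> = (L G \<iota> \<union> Y \<inter> Q \<iota>) \<inter> P \<mu>" by blast
    qed (use XY in blast)
    with s \<kappa>(3) show "s \<in> H G \<iota> Y" by (auto simp: H_def)
  qed
  then have G_fix: "G \<iota> = H G \<iota> (G \<iota>)" for \<iota>
    using lfp_unfold[of "H G \<iota>"] by (simp only: G_lfp[symmetric])
  \<comment> \<open>\<open>G \<kappa>\<close> lives on the whole class of \<open>\<kappa>\<close>;
    only its layer at \<open>\<kappa>\<close> is kept.\<close>
  define C where "C = (\<Union>\<kappa>. G \<kappa> \<inter> P \<kappa>)"
  have C_P: "C \<inter> P \<kappa> = G \<kappa> \<inter> P \<kappa>" for \<kappa>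
    using disj unfolding C_def by blast
  have "C \<inter> P \<iota> = \<Phi> C \<inter> P \<iota>" for \<iota>
  proof -
    \<comment> \<open>\<open>Z\<close> is the set to which \<open>G_fix\<close> applies
      \<open>\<Phi>\<close> at \<open>\<iota>\<close>. It agrees with \<open>C\<close> on all layers
      at or below \<open>\<iota>\<close>, the only ones that \<open>mono\<close> looks at.\<close>
    define Z where "Z = L G \<iota> \<union> G \<iota> \<inter> Q \<iota>"
    have Z: "Z \<inter> P \<kappa> = C \<inter> P \<kappa>" if "ge \<iota> \<kappa>" for \<kappa>
    proof (cases "ge \<kappa> \<iota>")
      case True
      have "L G \<iota> \<inter> P \<kappa> = {}" using True disj unfolding L_def sort_gt_def by blast
      moreover have "P \<kappa> \<subseteq> Q \<iota>" using that True by (auto simp: Q_def)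
      ultimately show ?thesis using G_cong[OF that True] C_P[of \<kappa>] unfolding Z_def by blast
    next
      case False
      then have gt: "sort_gt ge \<iota> \<kappa>" using that by (simp add: sort_gt_def)
      have "L G \<iota> \<inter> P \<kappa> = G \<kappa> \<inter> P \<kappa>" using gt disj unfolding L_def by blast
      with Q_gt[OF gt] C_P[of \<kappa>] show ?thesis unfolding Z_def by blast
    qed
    \<comment> \<open>Since the relevant layers are equal, \<open>mono\<close> applies in both
      directions.\<close>
    have "\<Phi> Z \<inter> P \<iota> = \<Phi> C \<inter> P \<iota>"
      by (rule equalityI; rule mono) (use Z in \<open>auto simp: sort_gt_def\<close>)
    moreover have "G \<iota> \<inter> P \<iota> = \<Phi> Z \<inter> P \<iota>"
      using refl[of \<iota>] by (subst G_fix) (auto simp: H_def Z_def Q_def)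
    ultimately show ?thesis using C_P by simp
  qed
  moreover have "C \<subseteq> (\<Union>\<iota>. P \<iota>)" by (auto simp: C_def)
  ultimately have "C = \<Phi> C" using cover[of C] by blast
  then show ?thesis by (rule that)
qed


section \<open>Accessibility and computability\<close>

text \<open>Peels off one arrow at a time, in step with the recursion of
  \<open>computable_at\<close>.\<close>

lemma ge_plus_simps:
  "ge_plus ge \<iota> (Sort \<kappa>) \<longleftrightarrow> ge \<iota> \<kappa>"
  "ge_plus ge \<iota> (\<sigma> \<rightarrow> \<tau>) \<longleftrightarrow> gt_minus ge \<iota> \<sigma> \<and> ge_plus ge \<iota> \<tau>"
  by (auto simp: ge_plus.simps)

lemma gt_minus_simps:
  "gt_minus ge \<iota> (Sort \<kappa>) \<longleftrightarrow> sort_gt ge \<iota> \<kappa>"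
  "gt_minus ge \<iota> (\<sigma> \<rightarrow> \<tau>) \<longleftrightarrow> ge_plus ge \<iota> \<sigma> \<and> gt_minus ge \<iota> \<tau>"
  by (auto simp: gt_minus.simps)

section \<open>Comparison of sets of base-type terms up to a sort\<close>

definition sort_terms ::
  "('s, 'f, 'v, 'm) signature \<Rightarrow> 's \<Rightarrow> ('s, 'f, 'v, 'm) mterm set" where
  "sort_terms \<Sigma> \<iota> = {s. term_of_type \<Sigma> s (Sort \<iota>)}"

text \<open>The premises of \<open>mono\<close> in \<open>stratified_fixpoint\<close> as a relation.
  Equality strictly below \<open>\<iota>\<close> serves negative positions, where
  \<open>gt_minus\<close> admits only such sorts at base type.\<close>

definition le_upto ::
  "('s, 'f, 'v, 'm) signature \<Rightarrow> ('s \<Rightarrow> 's \<Rightarrow> bool) \<Rightarrow> 's \<Rightarrow>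
   ('s, 'f, 'v, 'm) mterm set \<Rightarrow> ('s, 'f, 'v, 'm) mterm set \<Rightarrow> bool" where
  "le_upto \<Sigma> ge \<iota> X Y \<longleftrightarrow>
     (\<forall>\<kappa>. ge \<iota> \<kappa> \<longrightarrow> X \<inter> sort_terms \<Sigma> \<kappa> \<subseteq> Y \<inter> sort_terms \<Sigma> \<kappa>) \<and>
     (\<forall>\<kappa>. sort_gt ge \<iota> \<kappa> \<longrightarrow> X \<inter> sort_terms \<Sigma> \<kappa> = Y \<inter> sort_terms \<Sigma> \<kappa>)"

text \<open>Accessibility steps can descend from \<open>\<iota>\<close> to smaller sorts, where the
  comparison has to remain available.\<close>

lemma le_upto_downward:
  assumes "sort_ordering ge" and "le_upto \<Sigma> ge \<iota> X Y" and "ge \<iota> \<kappa>"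
  shows "le_upto \<Sigma> ge \<kappa> X Y"
proof -
  have trans: "ge \<mu> \<nu> \<Longrightarrow> ge \<nu> \<xi> \<Longrightarrow> ge \<mu> \<xi>" for \<mu> \<nu> \<xi>
    using assms(1) by (auto simp: sort_ordering_def dest: transpD)
  have "ge \<iota> \<mu>" if "ge \<kappa> \<mu>" for \<mu> using trans assms(3) that by blast
  moreover have "sort_gt ge \<iota> \<mu>" if "sort_gt ge \<kappa> \<mu>" for \<mu>
    using trans assms(3) that unfolding sort_gt_def by blast
  ultimately show ?thesis using assms(2) by (simp add: le_upto_def)
qed

text \<open>One induction proves both claims, because passing to an argument type exchanges
  \<open>ge_plus\<close> and \<open>gt_minus\<close> and with them the direction.\<close>

lemma computable_at_le_upto:
  assumes "le_upto \<Sigma> ge \<iota> X Y"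
  shows "ge_plus ge \<iota> \<sigma> \<longrightarrow> computable_at \<Sigma> X \<sigma> s \<longrightarrow> computable_at \<Sigma> Y \<sigma> s"
    and "gt_minus ge \<iota> \<sigma> \<longrightarrow> computable_at \<Sigma> Y \<sigma> s \<longrightarrow> computable_at \<Sigma> X \<sigma> s"
proof (induction \<sigma> arbitrary: s)
  case (Sort \<kappa>)
  case 1
  show ?case using assms by (auto simp: ge_plus_simps le_upto_def sort_terms_def)
next
  case (Sort \<kappa>)
  case 2
  show ?case using assms by (auto simp: gt_minus_simps le_upto_def sort_terms_def)
next
  case (Arrow \<sigma> \<tau>)
  case 1
  show ?case using Arrow by (auto simp: ge_plus_simps)
next
  case (Arrow \<sigma> \<tau>)
  case 2
  show ?case using Arrow by (auto simp: gt_minus_simps)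
qed

lemma computable_at_term_of_type: "computable_at \<Sigma> I \<sigma> s \<Longrightarrow> term_of_type \<Sigma> s \<sigma>"
  by (cases \<sigma>) auto

lemma computable_iff: "has_type \<Sigma> s \<sigma> \<Longrightarrow> computable \<Sigma> I s \<longleftrightarrow> computable_at \<Sigma> I \<sigma> s"
  unfolding computable_def
  by (metis computable_at_term_of_type has_type_unique term_of_type_def)

text \<open>Base type forces \<open>f\<close> to be fully applied, so \<open>\<iota>\<close> is its
  output sort, the one that \<open>Acc\<close> compares with.\<close>

lemma accessible_argument:
  assumes "term_of_type \<Sigma> (apps (Fun f) ss) (Sort \<iota>)" and "i \<in> Acc \<Sigma> ge f"
  obtains \<sigma> where "has_type \<Sigma> (ss ! (i - 1)) \<sigma>" and "ge_plus ge \<iota> \<sigma>"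
proof -
  from assms(1) obtain \<sigma>s
    where \<sigma>s: "has_type \<Sigma> (Fun f) (arrows \<sigma>s (Sort \<iota>))" "list_all2 (has_type \<Sigma>) ss \<sigma>s"
    by (auto simp: term_of_type_def elim: has_type_appsE)
  have f: "fun_ty \<Sigma> f = arrows \<sigma>s (Sort \<iota>)" using has_type_FunD[OF \<sigma>s(1)] by simp
  have "i - 1 < length ss" "ge_plus ge \<iota> (\<sigma>s ! (i - 1))"
    using assms(2) list_all2_lengthD[OF \<sigma>s(2)] by (auto simp: Acc_def f)
  with \<sigma>s(2) show ?thesis by (auto intro!: that dest: list_all2_nthD)
qed

text \<open>The terms \<open>ts\<close> sit at negative positions of an accessible type, so their
  computability passes from \<open>Y\<close> back to \<open>X\<close>. The bound on the sort of
  \<open>v\<close> allows iteration along a sequence.\<close>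

lemma acc_red_le_upto:
  assumes ord: "sort_ordering ge" and le: "le_upto \<Sigma> ge \<iota> X Y"
    and step: "acc_red \<Sigma> ge Y u v" and u: "u \<in> sort_terms \<Sigma> \<kappa>" and \<kappa>: "ge \<iota> \<kappa>"
  shows "acc_red \<Sigma> ge X u v \<and> (\<exists>\<mu>. ge \<iota> \<mu> \<and> v \<in> sort_terms \<Sigma> \<mu>)"
  using step
proof cases
  case (1 f i ts ss)
  obtain \<sigma> where \<sigma>: "has_type \<Sigma> (ss ! (i - 1)) \<sigma>" "ge_plus ge \<kappa> \<sigma>"
    using accessible_argument[of \<Sigma> f ss \<kappa> i ge] u 1 by (auto simp: sort_terms_def)
  obtain \<mu> where \<mu>: "term_of_type \<Sigma> v (Sort \<mu>)" using 1 by (auto simp: base_terms_def)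
  then obtain \<sigma>s where \<sigma>s: "has_type \<Sigma> (ss ! (i - 1)) (arrows \<sigma>s (Sort \<mu>))"
      "list_all2 (has_type \<Sigma>) ts \<sigma>s"
    using 1 by (auto simp: term_of_type_def elim: has_type_appsE)
  have "\<sigma> = arrows \<sigma>s (Sort \<mu>)" using \<sigma>(1) \<sigma>s(1) by (rule has_type_unique)
  \<comment> \<open>Accessibility of this type bounds its output sort by \<open>\<kappa>\<close> and
    makes every argument type negative.\<close>
  then have ge: "ge \<kappa> \<mu>" "\<forall>\<tau>\<in>set \<sigma>s. gt_minus ge \<kappa> \<tau>"
    using \<sigma>(2) by (auto simp: ge_plus.simps[of ge \<kappa> "arrows \<sigma>s (Sort \<mu>)"])
  have X: "computable \<Sigma> X t" if t: "t \<in> set ts" for t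
  proof -
    obtain \<tau> where \<tau>: "\<tau> \<in> set \<sigma>s" "has_type \<Sigma> t \<tau>"
      using t \<sigma>s(2) by (metis list_all2_conv_all_nth in_set_conv_nth)
    have "computable_at \<Sigma> Y \<tau> t" using 1 t computable_iff[OF \<tau>(2)] by blast
    then have "computable_at \<Sigma> X \<tau> t"
      using computable_at_le_upto(2)[OF le_upto_downward[OF ord le \<kappa>]] ge(2) \<tau>(1) by blast
    then show ?thesis by (auto simp: computable_def)
  qed
  have "acc_red \<Sigma> ge X u v"
    unfolding 1(1,2) by (rule acc_red.intros) (use 1 X in auto)
  moreover have "ge \<iota> \<mu>"
    using ord \<kappa> ge(1) by (auto simp: sort_ordering_def dest: transpD)
  ultimately show ?thesis
    using \<mu> by (auto simp: sort_terms_def)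
qed

section \<open>The condition on \<open>C\<close> as an operator, and its monotonicity\<close>

definition acc_step ::
  "('s, 'f, 'v, 'm) signature \<Rightarrow> ('s, 'f, 'v, 'm) rules \<Rightarrow> ('s \<Rightarrow> 's \<Rightarrow> bool) \<Rightarrow>
   ('s, 'f, 'v, 'm) mterm set \<Rightarrow> ('s, 'f, 'v, 'm) mterm set" where
  "acc_step \<Sigma> R ge C = {s \<in> base_terms \<Sigma>.
     terminating (\<lambda>u v. red \<Sigma> R u v \<or> acc_red \<Sigma> ge C u v) s \<and>
     (\<forall>f ss. f \<in> funs \<Sigma> \<and> (red \<Sigma> R)\<^sup>*\<^sup>* s (apps (Fun f) ss) \<longrightarrow>
        (\<forall>i \<in> Acc \<Sigma> ge f. computable \<Sigma> C (ss ! (i - 1))))}"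

text \<open>An infinite sequence for \<open>Y\<close> that starts at sort \<open>\<iota>\<close> is
  also one for \<open>X\<close>, by \<open>acc_red_le_upto\<close> at each of its steps.\<close>

lemma terminating_le_upto:
  assumes afsm: "afsm \<Sigma> R" and ord: "sort_ordering ge" and le: "le_upto \<Sigma> ge \<iota> X Y"
    and s: "s \<in> sort_terms \<Sigma> \<iota>"
    and sn: "terminating (\<lambda>u v. red \<Sigma> R u v \<or> acc_red \<Sigma> ge X u v) s"
  shows "terminating (\<lambda>u v. red \<Sigma> R u v \<or> acc_red \<Sigma> ge Y u v) s"
  unfolding terminating_def
proof (rule notI, elim exE conjE)
  fix S :: "nat \<Rightarrow> ('a, 'b, 'c, 'd) mterm"
  assume S0: "S 0 = s" and S: "\<forall>i. red \<Sigma> R (S i) (S (Suc i)) \<or> acc_red \<Sigma> ge Y (S i) (S (Suc i))"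
  \<comment> \<open>Rewriting keeps the sort and accessibility steps never leave the sorts at or
    below \<open>\<iota>\<close>, so the comparison applies throughout.\<close>
  have sorts: "\<exists>\<kappa>. ge \<iota> \<kappa> \<and> S i \<in> sort_terms \<Sigma> \<kappa>" for i
  proof (induction i)
    case 0
    show ?case using ord s S0 by (auto simp: sort_ordering_def dest: reflpD)
  next
    case (Suc i)
    then obtain \<kappa> where \<kappa>: "ge \<iota> \<kappa>" "S i \<in> sort_terms \<Sigma> \<kappa>" by blast
    from S have "red \<Sigma> R (S i) (S (Suc i)) \<or> acc_red \<Sigma> ge Y (S i) (S (Suc i))" ..
    then show ?case
    proof
      assume "red \<Sigma> R (S i) (S (Suc i))"
      with \<kappa> show ?thesis using red_preserves_type[OF afsm] by (auto simp: sort_terms_def)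
    next
      assume "acc_red \<Sigma> ge Y (S i) (S (Suc i))"
      from acc_red_le_upto[OF ord le this \<kappa>(2,1)] show ?thesis by blast
    qed
  qed
  have "red \<Sigma> R (S i) (S (Suc i)) \<or> acc_red \<Sigma> ge X (S i) (S (Suc i))" for i
  proof -
    obtain \<kappa> where "ge \<iota> \<kappa>" "S i \<in> sort_terms \<Sigma> \<kappa>" using sorts by blast
    then show ?thesis using S acc_red_le_upto[OF ord le, of "S i" "S (Suc i)" \<kappa>] by blast
  qed
  with sn S0 show False by (auto simp: terminating_def)
qed

text \<open>Subject reduction keeps every reduct at sort \<open>\<iota>\<close>, so its accessible
  arguments have types positive at \<open>\<iota>\<close> and their computability passes from
  \<open>X\<close> to \<open>Y\<close>.\<close>

lemma acc_step_le_upto: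
  assumes afsm: "afsm \<Sigma> R" and ord: "sort_ordering ge" and le: "le_upto \<Sigma> ge \<iota> X Y"
  shows "acc_step \<Sigma> R ge X \<inter> sort_terms \<Sigma> \<iota> \<subseteq> acc_step \<Sigma> R ge Y \<inter> sort_terms \<Sigma> \<iota>"
proof
  fix s assume "s \<in> acc_step \<Sigma> R ge X \<inter> sort_terms \<Sigma> \<iota>"
  then have s: "s \<in> acc_step \<Sigma> R ge X" "s \<in> sort_terms \<Sigma> \<iota>" by auto
  have "computable \<Sigma> Y (ss ! (i - 1))"
    if f: "f \<in> funs \<Sigma>" and reds: "(red \<Sigma> R)\<^sup>*\<^sup>* s (apps (Fun f) ss)" and i: "i \<in> Acc \<Sigma> ge f" for f ss i
  proof -
    have "term_of_type \<Sigma> (apps (Fun f) ss) (Sort \<iota>)"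
      using rtranclp_red_preserves_type[OF afsm reds] s(2) by (simp add: sort_terms_def)
    then obtain \<sigma> where \<sigma>: "has_type \<Sigma> (ss ! (i - 1)) \<sigma>" "ge_plus ge \<iota> \<sigma>"
      using i by (rule accessible_argument)
    have "computable \<Sigma> X (ss ! (i - 1))" using s(1) f reds i by (auto simp: acc_step_def)
    with \<sigma> show ?thesis using computable_at_le_upto(1)[OF le] by (simp add: computable_iff)
  qed
  with s terminating_le_upto[OF afsm ord le s(2)] show "s \<in> acc_step \<Sigma> R ge Y \<inter> sort_terms \<Sigma> \<iota>"
    by (auto simp: acc_step_def)
qed


section \<open>Fixpoints are RC-sets\<close>

lemma terminating_mono: "terminating r s \<Longrightarrow> (\<And>u v. q u v \<Longrightarrow> r u v) \<Longrightarrow> terminating q s"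
  unfolding terminating_def by blast

lemma terminating_successor: "terminating r s \<Longrightarrow> r s t \<Longrightarrow> terminating r t"
  unfolding terminating_def
proof (erule contrapos_nn, elim exE conjE)
  fix S :: "nat \<Rightarrow> 'a"
  assume "r s t" "S 0 = t" "\<forall>i. r (S i) (S (Suc i))"
  then show "\<exists>S. S 0 = s \<and> (\<forall>i. r (S i) (S (Suc i)))"
    by (intro exI[of _ "case_nat s S"]) (auto split: nat.split)
qed

lemma terminating_if_successors: "(\<And>t. r s t \<Longrightarrow> terminating r t) \<Longrightarrow> terminating r s"
  unfolding terminating_def
proof (rule notI, elim exE conjE)
  fix S :: "nat \<Rightarrow> 'a"
  assume *: "\<And>t. r s t \<Longrightarrow> \<nexists>S. S 0 = t \<and> (\<forall>i. r (S i) (S (Suc i)))"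
    and "S 0 = s" and S: "\<forall>i. r (S i) (S (Suc i))"
  then have "r s (S (Suc 0))" by metis
  from *[OF this] S show False by (auto dest!: spec[of _ "\<lambda>i. S (Suc i)"])
qed

text \<open>Unchanged by further arguments, it separates terms headed by a variable or an
  abstraction from those headed by a function symbol, from which alone accessibility steps
  start.\<close>

primrec head :: "('s, 'f, 'v, 'm) mterm \<Rightarrow> ('s, 'f, 'v, 'm) mterm" where
  "head (Var x) = Var x"
| "head (Bound i) = Bound i"
| "head (Fun f) = Fun f"
| "head (App s t) = head s"
| "head (Abs \<sigma> s) = Abs \<sigma> s"
| "head (Meta Z ss) = Meta Z ss"

lemma head_apps [simp]: "head (apps s ts) = head s"
  by (induction ts arbitrary: s) auto

text \<open>Closure under reduction holds as both conditions speak about all sequences from a term.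
  A term headed by a variable or a beta-redex has no accessibility step, so both conditions come
  down to its reducts.\<close>

lemma rc_set_fixpoint:
  assumes afsm: "afsm \<Sigma> R" and C: "C = acc_step \<Sigma> R ge C"
  shows "rc_set \<Sigma> R C"
  unfolding rc_set_def
proof (intro conjI ballI allI impI)
  show "C \<subseteq> base_terms \<Sigma>" using C by (auto simp: acc_step_def)
next
  fix s assume "s \<in> C"
  then have "s \<in> acc_step \<Sigma> R ge C" using C by simp
  then show "terminating (red \<Sigma> R) s" by (auto simp: acc_step_def elim: terminating_mono)
next
  fix s t assume "s \<in> C" and t: "red \<Sigma> R s t"
  then have s: "s \<in> acc_step \<Sigma> R ge C" using C by simp
  have "t \<in> base_terms \<Sigma>"
    using s red_preserves_type[OF afsm t] by (auto simp: acc_step_def base_terms_def)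
  moreover have "terminating (\<lambda>u v. red \<Sigma> R u v \<or> acc_red \<Sigma> ge C u v) t"
    using s t by (auto simp: acc_step_def elim: terminating_successor)
  ultimately have "t \<in> acc_step \<Sigma> R ge C"
    using s t by (auto simp: acc_step_def intro: converse_rtranclp_into_rtranclp)
  then show "t \<in> C" using C by simp
next
  fix s assume s: "s \<in> base_terms \<Sigma>"
    and neutral: "(\<exists>x ss. s = apps (Var x) ss) \<or> (\<exists>x u s0 ss. s = apps (lam \<Sigma> x u) (s0 # ss))"
    and reducts: "\<forall>t. red \<Sigma> R s t \<longrightarrow> t \<in> C"
  have "head s \<noteq> Fun f" for f using neutral by (auto simp: lam_def)
  then have no_fun: "s \<noteq> apps (Fun f) ss" for f ss by (metis head.simps(3) head_apps)
  have reducts': "t \<in> acc_step \<Sigma> R ge C" if "red \<Sigma> R s t" for t using that reducts C by auto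
  have "terminating (\<lambda>u v. red \<Sigma> R u v \<or> acc_red \<Sigma> ge C u v) s"
  proof (rule terminating_if_successors)
    fix t assume "red \<Sigma> R s t \<or> acc_red \<Sigma> ge C s t"
    moreover have "\<not> acc_red \<Sigma> ge C s t" using no_fun by (metis acc_red.cases)
    ultimately have "red \<Sigma> R s t" by blast
    then show "terminating (\<lambda>u v. red \<Sigma> R u v \<or> acc_red \<Sigma> ge C u v) t"
      using reducts' by (auto simp: acc_step_def)
  qed
  \<comment> \<open>A function-headed reduct is reached in at least one step, since \<open>s\<close>
    is not of that form.\<close>
  moreover have "computable \<Sigma> C (ss ! (i - 1))"
    if "f \<in> funs \<Sigma>" "(red \<Sigma> R)\<^sup>*\<^sup>* s (apps (Fun f) ss)" "i \<in> Acc \<Sigma> ge f" for f ss i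
    using that(2)
  proof (cases rule: converse_rtranclpE)
    case base
    then show ?thesis using no_fun by blast
  next
    case (step t)
    then show ?thesis using reducts' that by (auto simp: acc_step_def)
  qed
  ultimately have "s \<in> acc_step \<Sigma> R ge C" using s by (auto simp: acc_step_def)
  then show "s \<in> C" using C by simp
qed

theorem theorem13:
  fixes \<Sigma> :: "('s, 'f, 'v, 'm) signature"
    and R :: "('s, 'f, 'v, 'm) rules"
    and ge :: "'s \<Rightarrow> 's \<Rightarrow> bool"
  assumes "afsm \<Sigma> R"
    and "sort_ordering ge"
  shows "\<exists>C. rc_set \<Sigma> R C \<and>
    C = {s \<in> base_terms \<Sigma>.
           terminating (\<lambda>u v. red \<Sigma> R u v \<or> acc_red \<Sigma> ge C u v) s \<and>
           (\<forall>f ss. f \<in> funs \<Sigma> \<and> (red \<Sigma> R)\<^sup>*\<^sup>* s (apps (Fun f) ss) \<longrightarrow>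
              (\<forall>i \<in> Acc \<Sigma> ge f. computable \<Sigma> C (ss ! (i - 1))))}"
proof -
  \<comment> \<open>The layers are the terms of each sort, disjoint by uniqueness of types.\<close>
  obtain C where C: "C = acc_step \<Sigma> R ge C"
  proof (rule stratified_fixpoint[OF assms(2), of "sort_terms \<Sigma>" "acc_step \<Sigma> R ge"])
    fix s \<iota> \<kappa> assume "s \<in> sort_terms \<Sigma> \<iota>" "s \<in> sort_terms \<Sigma> \<kappa>"
    then show "\<iota> = \<kappa>" using term_of_type_unique by (fastforce simp: sort_terms_def)
  next
    fix X show "acc_step \<Sigma> R ge X \<subseteq> (\<Union>\<iota>. sort_terms \<Sigma> \<iota>)"
      by (auto simp: acc_step_def base_terms_def sort_terms_def)
  next
    fix \<iota> X Y
    assume "\<And>\<kappa>. ge \<iota> \<kappa> \<Longrightarrow> X \<inter> sort_terms \<Sigma> \<kappa> \<subseteq> Y \<inter> sort_terms \<Sigma> \<kappa>"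
      and "\<And>\<kappa>. sort_gt ge \<iota> \<kappa> \<Longrightarrow> X \<inter> sort_terms \<Sigma> \<kappa> = Y \<inter> sort_terms \<Sigma> \<kappa>"
    then show "acc_step \<Sigma> R ge X \<inter> sort_terms \<Sigma> \<iota> \<subseteq> acc_step \<Sigma> R ge Y \<inter> sort_terms \<Sigma> \<iota>"
      by (intro acc_step_le_upto[OF assms]) (simp add: le_upto_def)
  qed
  show ?thesis
    using rc_set_fixpoint[OF assms(1) C] C[unfolded acc_step_def] by blast
qed

end
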